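(* Let $k$ be a positive integer and let $G$ and $H$ be finite simple undirected graphs. Then $$\gamma_{\{k\}}(G)\,\gamma_{\{k\}}(H) \leq 2k\,\gamma_{\{k\}}(G \Box H).$$
   Context: All graphs are finite, simple and undirected; all multisets are finite. For a vertex $v$ of a graph $G$, $N_G[v]$ denotes the closed neighborhood of $v$ (the neighbors of $v$ together with $v$ itself). The cardinality of a multiset counts elements with multiplicity. A $\{k\}$-dominating multiset of a graph $G$ is a multiset $D_k$ of vertices of $G$ such that, for each $v \in V(G)$, the number of vertices of $N_G[v]$ contained in $D_k$, counted with multiplicity, is at least $k$. The minimum cardinality of a $\{k\}$-dominating multiset of $G$ is denoted $\gamma_{\{k\}}(G)$. The Cartesian product $G \Box H$ is the graph with vertex set $V(G)\times V(H)$, in which $gh$ and $g'h'$ are adjacent whenever $g=g'$ and $(h,h')\in E(H)$, or $h=h'$ and $(g,g')\in E(G)$. *)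

theory Defs
  imports "HOL-Library.Multiset" "Graph_Theory.Pair_Digraph"
begin

text \<open>
  A finite simple undirected graph is a \<^locale>\<open>pair_graph\<close>: finite, loop-free, and with a
  symmetric arc set, so that an undirected edge \<open>uv\<close> is given by the two arcs
  \<open>(u, v)\<close> and \<open>(v, u)\<close>.
\<close>

definition closed_nbhd :: "'a pair_pre_digraph \<Rightarrow> 'a \<Rightarrow> 'a set" where
  "closed_nbhd G v = insert v {u. (v, u) \<in> parcs G}"

definition k_dominating :: "nat \<Rightarrow> 'a pair_pre_digraph \<Rightarrow> 'a multiset \<Rightarrow> bool" where
  "k_dominating k G D \<longleftrightarrow>
     set_mset D \<subseteq> pverts G \<and>
     (\<forall>v \<in> pverts G. k \<le> size (filter_mset (\<lambda>u. u \<in> closed_nbhd G v) D))"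

definition k_domination_number :: "nat \<Rightarrow> 'a pair_pre_digraph \<Rightarrow> nat" where
  "k_domination_number k G = (LEAST n. \<exists>D. k_dominating k G D \<and> size D = n)"

definition cartesian_product ::
    "'a pair_pre_digraph \<Rightarrow> 'b pair_pre_digraph \<Rightarrow> ('a \<times> 'b) pair_pre_digraph" where
  "cartesian_product G H =
     \<lparr> pverts = pverts G \<times> pverts H,
       parcs = {((g, h), (g', h')).
         (g = g' \<and> g \<in> pverts G \<and> (h, h') \<in> parcs H) \<or>
         (h = h' \<and> h \<in> pverts H \<and> (g, g') \<in> parcs G)} \<rparr>"

lemma pair_graph_cartesian_product:
  assumes "pair_graph G" and "pair_graph H"
  shows "pair_graph (cartesian_product G H)"
proof -
  interpret G: pair_graph G by fact
  interpret H: pair_graph H by fact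
  have sub: "parcs (cartesian_product G H)
      \<subseteq> (pverts G \<times> pverts H) \<times> (pverts G \<times> pverts H)"
    by (auto simp: cartesian_product_def dest: G.wellformed' H.wellformed')
  have fin: "finite (pverts G \<times> pverts H)"
    using G.pair_finite_verts H.pair_finite_verts by simp
  have G_sym: "(a, b) \<in> parcs G \<longleftrightarrow> (b, a) \<in> parcs G" for a b
    by (blast dest: G.arcs_symmetric)
  have H_sym: "(a, b) \<in> parcs H \<longleftrightarrow> (b, a) \<in> parcs H" for a b
    by (blast dest: H.arcs_symmetric)
  have "(y, x) \<in> parcs (cartesian_product G H)"
    if "(x, y) \<in> parcs (cartesian_product G H)" for x y
  proof -
    obtain g h g' h' where [simp]: "x = (g, h)" "y = (g', h')"
      by (cases x, cases y)
    show ?thesis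
      using that G_sym[of g g'] H_sym[of h h'] by (auto simp: cartesian_product_def)
  qed
  then have sym: "symmetric (with_proj (cartesian_product G H))"
    unfolding symmetric_def with_proj_simps by (rule symI)
  have loop: "fst e \<noteq> snd e" if "e \<in> parcs (cartesian_product G H)" for e
    using that by (auto simp: cartesian_product_def dest: G.no_loops' H.no_loops')
  have verts: "pverts (cartesian_product G H) = pverts G \<times> pverts H"
    by (simp add: cartesian_product_def)
  have ends: "fst e \<in> pverts G \<times> pverts H \<and> snd e \<in> pverts G \<times> pverts H"
    if "e \<in> parcs (cartesian_product G H)" for e
    using sub that by (metis mem_Times_iff subsetD)
  have fin_arcs: "finite (parcs (cartesian_product G H))"
    using sub fin by (meson finite_SigmaI finite_subset)
  have wf: "pair_wf_digraph (cartesian_product G H)"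
    by (rule pair_wf_digraph.intro) (use ends verts in \<open>simp_all only:\<close>)
  show ?thesis
    unfolding pair_graph_def pair_digraph_def pair_pseudo_graph_def pair_fin_digraph_def
      pair_fin_digraph_axioms_def pair_loopfree_digraph_def pair_loopfree_digraph_axioms_def
      pair_sym_digraph_def pair_sym_digraph_axioms_def verts
    using wf fin fin_arcs sym loop by blast
qed

text \<open>
  On a finite graph the minimum in \<^const>\<open>k_domination_number\<close> is attained: taking every
  vertex with multiplicity \<open>k\<close> shows that the set of cardinalities is nonempty.
\<close>

lemma k_dominating_exists:
  assumes "finite (pverts G)"
  shows "\<exists>D. k_dominating k G D"
proof -
  define D where "D = (\<Sum>v\<in>pverts G. replicate_mset k v)"
  have set_D: "set_mset D \<subseteq> pverts G"
    using assms by (auto simp: D_def set_mset_sum split: if_splits)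
  have "k \<le> size (filter_mset (\<lambda>u. u \<in> closed_nbhd G v) D)" if "v \<in> pverts G" for v
  proof -
    have "replicate_mset k v \<subseteq># D"
      using that assms by (simp add: D_def sum.remove)
    then have "filter_mset (\<lambda>u. u \<in> closed_nbhd G v) (replicate_mset k v)
        \<subseteq># filter_mset (\<lambda>u. u \<in> closed_nbhd G v) D"
      by (rule multiset_filter_mono)
    moreover have "filter_mset (\<lambda>u. u \<in> closed_nbhd G v) (replicate_mset k v)
        = replicate_mset k v"
      by (auto simp: filter_mset_eq_conv closed_nbhd_def)
    ultimately show ?thesis
      using size_mset_mono by fastforce
  qed
  with set_D show ?thesis
    unfolding k_dominating_def by blast
qed

lemma k_domination_number_attained:
  assumes "finite (pverts G)"
  shows "\<exists>D. k_dominating k G D \<and> size D = k_domination_number k G"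
proof -
  obtain D where "k_dominating k G D"
    using k_dominating_exists[OF assms] by blast
  then have "\<exists>D'. k_dominating k G D' \<and> size D' = size D"
    by blast
  then show ?thesis
    unfolding k_domination_number_def by (rule LeastI)
qed

lemma k_domination_number_le:
  assumes "k_dominating k G D"
  shows "k_domination_number k G \<le> size D"
proof -
  from assms have "\<exists>D'. k_dominating k G D' \<and> size D' = size D"
    by blast
  then show ?thesis
    unfolding k_domination_number_def by (rule Least_le)
qed

end

theory Submission
  imports Defs "HOL-Number_Theory.Cong"
begin

text \<open>
  The idea combines the Clark--Suen argument with a cyclic labelling. Let \<open>D\<close> be a minimum
  dominating multiset of the product and \<open>u\<^sub>0, \<dots>\<close> and \<open>w\<^sub>0, \<dots>\<close> minimum dominating multisets of
  \<open>G\<close> and \<open>H\<close>. Every vertex \<open>g\<close> of \<open>G\<close> selects \<open>k\<close> distinct indices \<open>p g 0, \<dots>, p g (k - 1)\<close>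
  with \<open>u\<^bsub>p g c\<^esub>\<close> in its closed neighbourhood, and \<open>h\<close> selects \<open>q h 0, \<dots>, q h (k - 1)\<close>
  likewise. Let \<open>a g h\<close> count the elements of \<open>D\<close> that dominate \<open>(g, h)\<close> along \<open>G\<close>; at least
  \<open>k - a g h\<close> elements dominate it along \<open>H\<close>. The \<open>k \<times> k\<close> binary matrix with entry 1 at \<open>(c, d)\<close>
  iff \<open>(c + d) mod k < a g h\<close> has at most \<open>a g h\<close> ones in each column and at most \<open>k - a g h\<close>
  zeros in each row. A pair \<open>(i, j)\<close> of indices is put into \<open>A\<close> if every \<open>g\<close> selecting \<open>i\<close> has a
  1 in place \<open>(i, j)\<close> for some \<open>h\<close> selecting \<open>j\<close>; otherwise, some \<open>g\<close> selecting \<open>i\<close> has a 0 there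
  for all \<open>h\<close> selecting \<open>j\<close>. For fixed \<open>j\<close>, replacing the \<open>u\<^sub>i\<close> with \<open>(i, j) \<in> A\<close> by the
  projection of the part of \<open>D\<close> over the vertices selecting \<open>j\<close> leaves a dominating multiset of
  \<open>G\<close>, so by minimality there are at most as many such \<open>i\<close> as elements in that part; the pairs
  outside \<open>A\<close> are treated symmetrically. Each element of \<open>D\<close> lies over \<open>k\<close> indices on either side.
\<close>

lemma size_filter_mset_sum:
  assumes "finite X"
  shows "size (filter_mset (\<lambda>z. s z \<in> X \<and> P z) D)
    = (\<Sum>x\<in>X. size (filter_mset (\<lambda>z. s z = x \<and> P z) D))"
proof (induction D)
  case (add z D)
  have "(\<Sum>x\<in>X. size (filter_mset (\<lambda>z. s z = x \<and> P z) (add_mset z D)))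
    = (\<Sum>x\<in>X. (if s z = x then if P z then 1 else 0 else 0)
        + size (filter_mset (\<lambda>z. s z = x \<and> P z) D))"
    by (rule sum.cong) auto
  also have "\<dots> = (if s z \<in> X \<and> P z then 1 else 0)
      + (\<Sum>x\<in>X. size (filter_mset (\<lambda>z. s z = x \<and> P z) D))"
    using assms by (simp add: sum.distrib)
  finally show ?case
    using add.IH by simp
qed simp

text \<open>Double counting: each element of \<open>D\<close> contributes once per index
  \<open>i\<close> with \<open>Q i\<close>, hence at most \<open>k\<close> times.\<close>

lemma sum_size_filter_mset_le:
  assumes "finite I" and "\<And>z. z \<in># D \<Longrightarrow> card {i \<in> I. Q i z} \<le> k"
  shows "(\<Sum>i\<in>I. size (filter_mset (Q i) D)) \<le> k * size D"
  using assms(2)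
proof (induction D)
  case (add z D)
  have "(\<Sum>i\<in>I. size (filter_mset (Q i) (add_mset z D)))
    = (\<Sum>i\<in>I. (if Q i z then 1 else 0) + size (filter_mset (Q i) D))"
    by (rule sum.cong) auto
  also have "\<dots> = card {i \<in> I. Q i z} + (\<Sum>i\<in>I. size (filter_mset (Q i) D))"
    using assms(1) by (simp add: sum.distrib sum.If_cases Int_def)
  also have "\<dots> \<le> k + k * size D"
    using add.IH add.prems by (intro add_mono) auto
  finally show ?case by simp
qed simp

text \<open>Listing \<open>D\<close> turns repeated elements into separate positions, so
  multiplicities become distinct indices.\<close>

lemma k_dominating_selection:
  assumes "k_dominating k G D"
  obtains us p where "mset us = D"
    and "\<And>g. g \<in> pverts G \<Longrightarrow> inj_on (p g) {..<k}"
    and "\<And>g c. g \<in> pverts G \<Longrightarrow> c < k \<Longrightarrow> p g c < length us \<and> us ! p g c \<in> closed_nbhd G g"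
proof -
  obtain us where us: "mset us = D"
    using ex_mset by blast
  have "\<exists>f. inj_on f {..<k} \<and> f ` {..<k} \<subseteq> {i. i < length us \<and> us ! i \<in> closed_nbhd G g}"
    if g: "g \<in> pverts G" for g
  proof -
    let ?T = "{i. i < length us \<and> us ! i \<in> closed_nbhd G g}"
    have "k \<le> size (filter_mset (\<lambda>u. u \<in> closed_nbhd G g) (mset us))"
      using assms g us by (simp add: k_dominating_def)
    also have "\<dots> = card ?T"
      by (simp flip: mset_filter add: length_filter_conv_card)
    finally have "card {..<k} \<le> card ?T" by simp
    then show ?thesis
      by (subst conj_commute) (rule card_le_inj; simp)
  qed
  then obtain p where "\<And>g. g \<in> pverts G \<Longrightarrow> inj_on (p g) {..<k}
      \<and> p g ` {..<k} \<subseteq> {i. i < length us \<and> us ! i \<in> closed_nbhd G g}"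
    by metis
  then show thesis
    by (intro that[OF us, of p]) auto
qed

text \<open>Minimality: replacing the entries of \<open>us\<close> at \<open>R\<close> by
  \<open>E\<close> keeps it dominating, as \<open>cover\<close> restores what each \<open>g\<close>
  loses, so the size cannot drop.\<close>

lemma card_le_by_exchange:
  assumes us: "set us \<subseteq> pverts G" "length us = k_domination_number k G"
    and inj: "\<And>g. g \<in> pverts G \<Longrightarrow> inj_on (p g) {..<k}"
    and p: "\<And>g c. g \<in> pverts G \<Longrightarrow> c < k \<Longrightarrow> p g c < length us \<and> us ! p g c \<in> closed_nbhd G g"
    and R: "R \<subseteq> {..<length us}"
    and E: "set_mset E \<subseteq> pverts G"
    and cover: "\<And>g. g \<in> pverts G \<Longrightarrow>
      card {c. c < k \<and> p g c \<in> R} \<le> size (filter_mset (\<lambda>u. u \<in> closed_nbhd G g) E)"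
  shows "card R \<le> size E"
proof -
  let ?W = "image_mset ((!) us) (mset_set ({..<length us} - R))"
  have "k \<le> size (filter_mset (\<lambda>u. u \<in> closed_nbhd G g) (E + ?W))" if g: "g \<in> pverts G" for g
  proof -
    let ?C = "{c. c < k \<and> p g c \<in> R}"
    have "k - card ?C = card ({..<k} - ?C)"
      by (subst card_Diff_subset) auto
    also have "\<dots> = card (p g ` ({..<k} - ?C))"
      using inj[OF g] by (intro card_image[symmetric]) (auto intro: inj_on_subset)
    also have "\<dots> \<le> card {i \<in> {..<length us} - R. us ! i \<in> closed_nbhd G g}"
      using p[OF g] by (intro card_mono) auto
    also have "\<dots> = size (filter_mset (\<lambda>u. u \<in> closed_nbhd G g) ?W)"
      by (simp add: filter_mset_image_mset)
    finally show ?thesis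
      using cover[OF g] by simp
  qed
  moreover have "set_mset (E + ?W) \<subseteq> pverts G"
    using E us(1) by (auto simp: subset_iff)
  ultimately have "k_dominating k G (E + ?W)"
    by (simp add: k_dominating_def)
  then have "length us \<le> size (E + ?W)"
    using k_domination_number_le us(2) by fastforce
  also have "\<dots> = size E + (length us - card R)"
    using R by (simp add: card_Diff_subset finite_subset)
  \<comment> \<open>\<open>card R\<close> is at most \<open>length us\<close>, so the truncated
    subtraction is exact.\<close>
  finally show ?thesis
    using card_mono[OF _ R] by simp
qed

text \<open>
  The projections \<open>f\<close> and \<open>s\<close> are parameters so that both factors of the product are covered.
\<close>

lemma card_le_by_projection:
  assumes us: "set us \<subseteq> pverts G" "length us = k_domination_number k G"
    and inj: "\<And>g. g \<in> pverts G \<Longrightarrow> inj_on (p g) {..<k}"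
    and p: "\<And>g c. g \<in> pverts G \<Longrightarrow> c < k \<Longrightarrow> p g c < length us \<and> us ! p g c \<in> closed_nbhd G g"
    and R: "R \<subseteq> {..<length us}"
    and D: "\<And>z. z \<in># D \<Longrightarrow> f z \<in> pverts G"
    and X: "finite X"
    and S: "\<And>g c. g \<in> pverts G \<Longrightarrow> c < k \<Longrightarrow> p g c \<in> R \<Longrightarrow> \<exists>h\<in>X. c \<in> S g h"
    and fin_S: "\<And>g h. finite (S g h)"
    and card_S: "\<And>g h. g \<in> pverts G \<Longrightarrow> h \<in> X \<Longrightarrow>
      card (S g h) \<le> size (filter_mset (\<lambda>z. s z = h \<and> f z \<in> closed_nbhd G g) D)"
  shows "card R \<le> size (filter_mset (\<lambda>z. s z \<in> X) D)"
proof -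
  let ?E = "image_mset f (filter_mset (\<lambda>z. s z \<in> X) D)"
  have "card {c. c < k \<and> p g c \<in> R} \<le> size (filter_mset (\<lambda>u. u \<in> closed_nbhd G g) ?E)"
    if g: "g \<in> pverts G" for g
  proof -
    have "card {c. c < k \<and> p g c \<in> R} \<le> card (\<Union>h\<in>X. S g h)"
      using S[OF g] X fin_S by (intro card_mono) auto
    also have "\<dots> \<le> (\<Sum>h\<in>X. card (S g h))"
      using X by (rule card_UN_le)
    also have "\<dots> \<le> (\<Sum>h\<in>X. size (filter_mset (\<lambda>z. s z = h \<and> f z \<in> closed_nbhd G g) D))"
      using card_S[OF g] by (rule sum_mono)
    also have "\<dots> = size (filter_mset (\<lambda>u. u \<in> closed_nbhd G g) ?E)"
      using X by (simp add: size_filter_mset_sum[symmetric] filter_mset_image_mset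
          filter_filter_mset conj_commute)
    finally show ?thesis .
  qed
  then have "card R \<le> size ?E"
    by (intro card_le_by_exchange[OF us inj p R]) (use D in auto)
  then show ?thesis by simp
qed

lemma inj_on_add_mod: "inj_on (\<lambda>c. (c + d) mod k) {..<k}" for d k :: nat
proof (rule inj_onI)
  fix x y assume "x \<in> {..<k}" "y \<in> {..<k}" "(x + d) mod k = (y + d) mod k"
  then show "x = y"
    by (metis lessThan_iff cong_def cong_add_rcancel_nat mod_less)
qed

lemma card_add_mod_le:
  fixes d k :: nat
  shows "card {c. c < k \<and> (c + d) mod k \<in> T} \<le> card ({..<k} \<inter> T)"
  by (rule card_inj_on_le[where f = "\<lambda>c. (c + d) mod k"])
    (auto intro: inj_on_subset[OF inj_on_add_mod])

text \<open>As \<open>q\<close> is injective, at most one \<open>d\<close> carries the label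
  \<open>j\<close>, and the cyclic shift by that \<open>d\<close> is injective on
  \<open>{..<k}\<close>.\<close>

lemma card_labelled_add_mod_le:
  fixes k :: nat
  assumes "inj_on q {..<k}"
  shows "card {c. c < k \<and> (\<exists>d<k. q d = j \<and> (c + d) mod k \<in> T)} \<le> card ({..<k} \<inter> T)"
proof (cases "\<exists>d<k. q d = j")
  case True
  then obtain d where d: "d < k" "q d = j" by blast
  have "{c. c < k \<and> (\<exists>d<k. q d = j \<and> (c + d) mod k \<in> T)} = {c. c < k \<and> (c + d) mod k \<in> T}"
    using assms d by (auto dest: inj_onD)
  then show ?thesis
    by (simp add: card_add_mod_le)
next
  case False
  then have "{c. c < k \<and> (\<exists>d<k. q d = j \<and> (c + d) mod k \<in> T)} = {}" by blast
  then show ?thesis by (simp only: card.empty le0)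
qed

theorem theorem1:
  fixes k :: nat
    and G :: "'a pair_pre_digraph"
    and H :: "'b pair_pre_digraph"
  assumes "k > 0"
    and "pair_graph G"
    and "pair_graph H"
  shows "k_domination_number k G * k_domination_number k H
           \<le> 2 * k * k_domination_number k (cartesian_product G H)"
proof -
  let ?P = "cartesian_product G H"
  interpret G: pair_graph G by fact
  interpret H: pair_graph H by fact
  interpret P: pair_graph ?P by (rule pair_graph_cartesian_product) fact+
  have verts_P: "pverts ?P = pverts G \<times> pverts H"
    by (simp add: cartesian_product_def)
  obtain D where D: "k_dominating k ?P D" "size D = k_domination_number k ?P"
    using k_domination_number_attained[OF P.pair_finite_verts] by blast
  obtain U where U: "k_dominating k G U" "size U = k_domination_number k G"
    using k_domination_number_attained[OF G.pair_finite_verts] by blast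
  obtain W where W: "k_dominating k H W" "size W = k_domination_number k H"
    using k_domination_number_attained[OF H.pair_finite_verts] by blast
  obtain us p where us: "mset us = U"
    and p_inj: "\<And>g. g \<in> pverts G \<Longrightarrow> inj_on (p g) {..<k}"
    and p: "\<And>g c. g \<in> pverts G \<Longrightarrow> c < k \<Longrightarrow> p g c < length us \<and> us ! p g c \<in> closed_nbhd G g"
    using k_dominating_selection[OF U(1)] by blast
  obtain ws q where ws: "mset ws = W"
    and q_inj: "\<And>h. h \<in> pverts H \<Longrightarrow> inj_on (q h) {..<k}"
    and q: "\<And>h d. h \<in> pverts H \<Longrightarrow> d < k \<Longrightarrow> q h d < length ws \<and> ws ! q h d \<in> closed_nbhd H h"
    using k_dominating_selection[OF W(1)] by blast
  have us': "set us \<subseteq> pverts G" "length us = k_domination_number k G"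
    using U us by (auto simp: k_dominating_def)
  have ws': "set ws \<subseteq> pverts H" "length ws = k_domination_number k H"
    using W ws by (auto simp: k_dominating_def)
  have D_verts: "fst z \<in> pverts G" "snd z \<in> pverts H" if "z \<in># D" for z
    using D(1) that verts_P by (auto simp: k_dominating_def)

  define a where "a g h = size (filter_mset (\<lambda>z. snd z = h \<and> fst z \<in> closed_nbhd G g) D)" for g h
  define b where "b g h = size (filter_mset (\<lambda>z. fst z = g \<and> snd z \<in> closed_nbhd H h) D)" for g h
  have ab: "k \<le> a g h + b g h" if "g \<in> pverts G" "h \<in> pverts H" for g h
  proof -
    have "k \<le> size (filter_mset (\<lambda>z. z \<in> closed_nbhd ?P (g, h)) D)"
      using D(1) that verts_P by (auto simp: k_dominating_def)
    \<comment> \<open>Copies of \<open>(g, h)\<close> itself count in both parts, hence only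
      \<open>\<le>\<close>.\<close>
    also have "\<dots> \<le> size (filter_mset (\<lambda>z. snd z = h \<and> fst z \<in> closed_nbhd G g) D
        + filter_mset (\<lambda>z. fst z = g \<and> snd z \<in> closed_nbhd H h) D)"
      by (intro size_mset_mono)
        (auto simp: subseteq_mset_def closed_nbhd_def cartesian_product_def)
    finally show ?thesis
      by (simp add: a_def b_def)
  qed

  define X where "X i = {g \<in> pverts G. i \<in> p g ` {..<k}}" for i
  define Y where "Y j = {h \<in> pverts H. j \<in> q h ` {..<k}}" for j
  have fin_X: "finite (X i)" and fin_Y: "finite (Y j)" for i j
    by (simp_all add: X_def Y_def)
  define A where "A = {(i, j). \<forall>g\<in>pverts G. \<forall>c<k. p g c = i \<longrightarrow>
    (\<exists>h\<in>Y j. \<exists>d<k. q h d = j \<and> (c + d) mod k \<in> {..<a g h})}"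

  have col: "card {i. i < length us \<and> (i, j) \<in> A} \<le> size (filter_mset (\<lambda>z. snd z \<in> Y j) D)" for j
  proof (rule card_le_by_projection[OF us' p_inj p, where f = fst and S =
        "\<lambda>g h. {c. c < k \<and> (\<exists>d<k. q h d = j \<and> (c + d) mod k \<in> {..<a g h})}"])
    fix g h assume "g \<in> pverts G" and h: "h \<in> Y j"
    have "card {c. c < k \<and> (\<exists>d<k. q h d = j \<and> (c + d) mod k \<in> {..<a g h})}
      \<le> card ({..<k} \<inter> {..<a g h})"
      using q_inj h by (intro card_labelled_add_mod_le) (simp add: Y_def)
    also have "\<dots> \<le> card {..<a g h}"
      by (intro card_mono) auto
    finally show "card {c. c < k \<and> (\<exists>d<k. q h d = j \<and> (c + d) mod k \<in> {..<a g h})}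
      \<le> size (filter_mset (\<lambda>z. snd z = h \<and> fst z \<in> closed_nbhd G g) D)"
      by (simp add: a_def)
  qed (use D_verts fin_Y in \<open>auto simp: A_def\<close>)

  have row: "card {j. j < length ws \<and> (i, j) \<notin> A} \<le> size (filter_mset (\<lambda>z. fst z \<in> X i) D)" for i
  proof (rule card_le_by_projection[OF ws' q_inj q, where f = snd and S =
        "\<lambda>h g. {d. d < k \<and> (\<exists>c<k. p g c = i \<and> (d + c) mod k \<in> {a g h..})}"])
    fix h g assume h: "h \<in> pverts H" and g: "g \<in> X i"
    have "card {d. d < k \<and> (\<exists>c<k. p g c = i \<and> (d + c) mod k \<in> {a g h..})}
      \<le> card ({..<k} \<inter> {a g h..})"
      using p_inj g by (intro card_labelled_add_mod_le) (simp add: X_def)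
    also have "{..<k} \<inter> {a g h..} = {a g h..<k}" by auto
    \<comment> \<open>The interval is empty if \<open>a g h \<ge> k\<close>; otherwise
      \<open>ab\<close> bounds its length.\<close>
    also have "card \<dots> \<le> b g h"
      using ab[of g h] g h by (simp add: X_def)
    finally show "card {d. d < k \<and> (\<exists>c<k. p g c = i \<and> (d + c) mod k \<in> {a g h..})}
      \<le> size (filter_mset (\<lambda>z. fst z = g \<and> snd z \<in> closed_nbhd H h) D)"
      by (simp add: b_def)
  next
    fix h d assume h: "h \<in> pverts H" "d < k" and "q h d \<in> {j. j < length ws \<and> (i, j) \<notin> A}"
    \<comment> \<open>Being outside \<open>A\<close> gives a \<open>g\<close> whose entry is 0 for
      every \<open>h'\<close> selecting \<open>q h d\<close>, in particular for
      \<open>h\<close>.\<close>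
    then obtain g c where g: "g \<in> pverts G" "c < k" "p g c = i"
      and *: "\<And>h' d'. h' \<in> Y (q h d) \<Longrightarrow> d' < k \<Longrightarrow> q h' d' = q h d \<Longrightarrow> \<not> (c + d') mod k < a g h'"
      by (auto simp: A_def)
    have "h \<in> Y (q h d)"
      using h by (simp add: Y_def)
    with *[of h d] h have "(d + c) mod k \<in> {a g h..}"
      by (simp add: add.commute not_less)
    with g h show "\<exists>g\<in>X i. d \<in> {d. d < k \<and> (\<exists>c<k. p g c = i \<and> (d + c) mod k \<in> {a g h..})}"
      by (intro bexI[of _ g]) (auto simp: X_def)
  qed (use D_verts fin_X in auto)

  \<comment> \<open>Here \<open>y\<close> is a projection of an element of \<open>D\<close> and
    \<open>r\<close> its selection \<open>p y\<close> or \<open>q y\<close>.\<close>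
  have card_image_le_k: "card {i. i < m \<and> y \<in> V \<and> i \<in> r ` {..<k}} \<le> k"
    for m :: nat and y :: 'c and V and r :: "nat \<Rightarrow> nat"
    by (rule order_trans[OF card_mono[of "r ` {..<k}"]])
      (auto intro: order_trans[OF card_image_le])
  have sum_Y: "(\<Sum>j<length ws. size (filter_mset (\<lambda>z. snd z \<in> Y j) D)) \<le> k * size D"
    by (rule sum_size_filter_mset_le) (simp_all add: Y_def card_image_le_k del: image_iff)
  have sum_X: "(\<Sum>i<length us. size (filter_mset (\<lambda>z. fst z \<in> X i) D)) \<le> k * size D"
    by (rule sum_size_filter_mset_le) (simp_all add: X_def card_image_le_k del: image_iff)

  let ?m = "length us" and ?n = "length ws"
  have "?m * ?n = (\<Sum>i<?m. \<Sum>j<?n. 1)"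
    by simp
  also have "\<dots> = (\<Sum>i<?m. \<Sum>j<?n.
      (if (i, j) \<in> A then 1 else 0) + (if (i, j) \<notin> A then 1 else 0))"
    by (intro sum.cong) auto
  also have "\<dots> = (\<Sum>i<?m. \<Sum>j<?n. (if (i, j) \<in> A then 1 else 0))
      + (\<Sum>i<?m. \<Sum>j<?n. (if (i, j) \<notin> A then 1 else 0))"
    by (simp only: sum.distrib)
  \<comment> \<open>Pairs in \<open>A\<close> are counted by columns to match \<open>col\<close>,
    the others by rows to match \<open>row\<close>.\<close>
  also have "(\<Sum>i<?m. \<Sum>j<?n. (if (i, j) \<in> A then 1 else 0))
      = (\<Sum>j<?n. card {i. i < ?m \<and> (i, j) \<in> A})"
    by (subst sum.swap) (simp add: sum.If_cases Int_def)
  also have "(\<Sum>i<?m. \<Sum>j<?n. (if (i, j) \<notin> A then 1 else 0))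
      = (\<Sum>i<?m. card {j. j < ?n \<and> (i, j) \<notin> A})"
    by (intro sum.cong refl, subst sum.If_cases) (auto simp: Int_def)
  also have "(\<Sum>j<?n. card {i. i < ?m \<and> (i, j) \<in> A}) + (\<Sum>i<?m. card {j. j < ?n \<and> (i, j) \<notin> A})
      \<le> k * size D + k * size D"
    by (intro add_mono order_trans[OF sum_mono sum_Y] order_trans[OF sum_mono sum_X] col row)
  finally show ?thesis
    using us'(2) ws'(2) D(2) by simp
qed

end
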